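(* Suppose the operator regularity assumption (stated in the context) holds. For $i=1,\ldots,N-1$ let $$C^{e}_{\delta_i}:=4C_v^2L_{\nabla f}^2\sum_{j=i}^{N-1}\Big[\sum_{k=0}^{j}(3C_{\nabla f}^2)^{k}\Big](2L_f^2)^{j-i},\qquad C^{e}_{\varepsilon_{i+1}}:=2\sum_{j=1}^{i}(3C_{\nabla f}^2)^{j}.$$ Then for all $t=1,2,\ldots,T$, $$\mathbb{E}\big[\|\tilde{\boldsymbol{u}}^{(t)}-\boldsymbol{u}^{(t)}\|^2\big]\le\sum_{i=1}^{N-1}C^{e}_{\delta_i}\,\mathbb{E}\big[\|\delta_i^{(t)}\|^2\big]+\sum_{i=1}^{N-1}C^{e}_{\varepsilon_{i+1}}\,\mathbb{E}\big[\|\varepsilon_{i+1}^{(t)}\|^2\big].$$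
   Context: Setting. Let $N\ge 2$, let $d_0,\ldots,d_{N-1},d_{w_1},\ldots,d_{w_N}$ be positive integers and $d_N=1$. For $i=1,\ldots,N$ let $f_i:\mathbb{R}^{d_{i-1}}\times\mathbb{R}^{d_{w_i}}\to\mathbb{R}^{d_i}$ be twice differentiable operators, and let $\mathcal{R}:\mathbb{R}^d\to\mathbb{R}$ be differentiable, where $\boldsymbol{w}=(w_1^\top,\ldots,w_N^\top)^\top\in\mathbb{R}^d$, $d=\sum_i d_{w_i}$. $\nabla_1 f_i\in\mathbb{R}^{d_i\times d_{i-1}}$ and $\nabla_2 f_i\in\mathbb{R}^{d_i\times d_{w_i}}$ denote the Jacobians of $f_i$ with respect to $y_{i-1}$ and $w_i$, and $\nabla^2_{21}f_i\in\mathbb{R}^{d_i\times d_{w_i}\times d_{i-1}}$ is the derivative of $\nabla_2 f_i$ with respect to $y_{i-1}$. Norms. $\|\cdot\|$ is the Euclidean norm for vectors and the Frobenius norm for matrices and tensors; $\|\cdot\|_{\mathrm{op}}$ is the induced operator norm. For $\mathcal{H}\in\mathbb{R}^{p\times m\times n}$ and $A\in\mathbb{R}^{m\times n}$, $[\mathcal{H}(A)]_j=\sum_{\alpha,\beta}\mathcal{H}_{j\alpha\beta}A_{\alpha\beta}$ and $\|\mathcal{H}\|_{\mathrm{op}}=\sup_{\|A\|=1}\|\mathcal{H}(A)\|$. Perturbed SGD. At iteration $t$, with current weights $\boldsymbol{w}^{(t)}$, data sample $x^{(t)}\in\mathbb{R}^{d_0}$, and random perturbations $\delta_i^{(t)}$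 (forward) and $\varepsilon_i^{(t)}$ (backward): $\tilde y_0^{(t)}=x^{(t)}$, $\tilde y_i^{(t)}=f_i(\tilde y_{i-1}^{(t)},w_i^{(t)})+\delta_i^{(t)}$ for $i=1,\ldots,N$; $\tilde v_N^{(t)}=1$, $\tilde v_{i-1}^{(t)}=\nabla_1 f_i(\tilde y_{i-1}^{(t)},w_i^{(t)})^\top\tilde v_i^{(t)}+\varepsilon_i^{(t)}$ for $i=N,\ldots,2$; $\tilde u_i^{(t)}=\nabla_2 f_i(\tilde y_{i-1}^{(t)},w_i^{(t)})^\top\tilde v_i^{(t)}$ for $i=N,\ldots,1$; and $w_i^{(t+1)}=w_i^{(t)}-\gamma(\tilde u_i^{(t)}+r_i^{(t)})$ with step size $\gamma>0$ and $r_i^{(t)}=\nabla_{w_i}\mathcal{R}(\boldsymbol{w}^{(t)})$. The unperturbed quantities at the same $\boldsymbol{w}^{(t)}$ and $x^{(t)}$ are $y_0^{(t)}=x^{(t)}$, $y_i^{(t)}=f_i(y_{i-1}^{(t)},w_i^{(t)})$, $v_N^{(t)}=1$, $v_{i-1}^{(t)}=\nabla_1 f_i(y_{i-1}^{(t)},w_i^{(t)})^\top v_i^{(t)}$, $u_i^{(t)}=\nabla_2 f_i(y_{i-1}^{(t)},w_i^{(t)})^\top v_i^{(t)}$. Boldface denotes stacking: $\boldsymbol{u}^{(t)}=(u_1^{(t)\top},\ldots,u_N^{(t)\top})^\top$, $\tilde{\boldsymbol{u}}^{(t)}$ likewise. Operator regularity assumption. There exist constants $C_{\nabla f},C_{\nabla^2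 f},L_f,L_{\nabla f},L_{\nabla^2 f}>0$ such that for each $i$ and all $y_{i-1},w_i$: (1) $\|\nabla_j f_i(y_{i-1},w_i)\|_{\mathrm{op}}\le C_{\nabla f}$ for $j=1,2$ and $\|\nabla^2_{21}f_i(y_{i-1},w_i)\|_{\mathrm{op}}\le C_{\nabla^2 f}$; (2) $f_i$ is $L_f$-Lipschitz in $y_{i-1}$ (Euclidean norm); (3) $\nabla f_i$ and $\nabla^2 f_i$ are Lipschitz with respect to both $y_{i-1}$ and $w_i$ with constants $L_{\nabla f}$ and $L_{\nabla^2 f}$ respectively (Frobenius norm). Constant. $C_v:=\max\{1,C_{\nabla f}^N\}$ (it satisfies $\|v_i^{(t)}\|\le C_v$). *)

theory Defs
  imports "HOL-Probability.Probability" "Jordan_Normal_Form.Matrix"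
begin

unbundle no vec_syntax
hide_type (open) Finite_Cartesian_Product.vec
hide_const (open) Finite_Cartesian_Product.vec Finite_Cartesian_Product.mat
  Finite_Cartesian_Product.row Finite_Cartesian_Product.rows
  Finite_Cartesian_Product.column Finite_Cartesian_Product.columns
  Determinants.det

text \<open>
  The layer dimensions depend on the layer index, so \<open>R\<^sup>n\<close> is represented by
  \<open>carrier_vec n\<close> and real \<open>p \<times> n\<close> matrices by \<open>carrier_mat p n\<close>. A tensor in
  \<open>R\<^sup>(p \<times> m \<times> n)\<close> is a function \<open>H j a b\<close> of which only the entries with
  \<open>j < p\<close>, \<open>a < m\<close>, \<open>b < n\<close> matter; its dimensions are passed explicitly.
\<close>

type_synonym tensor = "nat \<Rightarrow> nat \<Rightarrow> nat \<Rightarrow> real"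

definition vnorm :: "real vec \<Rightarrow> real" where
  "vnorm v = L2_set (\<lambda>k. v $ k) {..<dim_vec v}"

definition fro_norm :: "real mat \<Rightarrow> real" where
  "fro_norm A = L2_set (\<lambda>ij. A $$ ij) ({..<dim_row A} \<times> {..<dim_col A})"

definition op_norm :: "real mat \<Rightarrow> real" where
  "op_norm A = Sup {vnorm (A *\<^sub>v x) | x. x \<in> carrier_vec (dim_col A) \<and> vnorm x = 1}"

definition tensor_fro :: "nat \<Rightarrow> nat \<Rightarrow> nat \<Rightarrow> tensor \<Rightarrow> real" where
  "tensor_fro p m n H = L2_set (\<lambda>(j, a, b). H j a b) ({..<p} \<times> {..<m} \<times> {..<n})"

definition tensor_app :: "nat \<Rightarrow> nat \<Rightarrow> nat \<Rightarrow> tensor \<Rightarrow> real mat \<Rightarrow> real vec" where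
  "tensor_app p m n H A = vec p (\<lambda>j. \<Sum>a<m. \<Sum>b<n. H j a b * A $$ (a, b))"

definition tensor_op_norm :: "nat \<Rightarrow> nat \<Rightarrow> nat \<Rightarrow> tensor \<Rightarrow> real" where
  "tensor_op_norm p m n H =
     Sup {vnorm (tensor_app p m n H A) | A. A \<in> carrier_mat m n \<and> fro_norm A = 1}"


text \<open>Frechet differentiability at \<open>z\<close> of a real function on \<open>R\<^sup>n\<close>. Vector- and matrix-valued
  maps are differentiable iff all their entries are.\<close>

definition frechet_differentiable :: "nat \<Rightarrow> (real vec \<Rightarrow> real) \<Rightarrow> real vec \<Rightarrow> bool" where
  "frechet_differentiable n g z \<longleftrightarrow>
     (\<exists>D \<in> carrier_vec n. \<forall>e>0. \<exists>s>0. \<forall>h \<in> carrier_vec n. vnorm h < s \<longrightarrow>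
        \<bar>g (z + h) - g z - (\<Sum>k<n. D $ k * h $ k)\<bar> \<le> e * vnorm h)"

definition partial_deriv :: "nat \<Rightarrow> nat \<Rightarrow> (real vec \<Rightarrow> real) \<Rightarrow> real vec \<Rightarrow> real" where
  "partial_deriv n k g z = deriv (\<lambda>s. g (z + s \<cdot>\<^sub>v unit_vec n k)) 0"

definition gradient :: "nat \<Rightarrow> (real vec \<Rightarrow> real) \<Rightarrow> real vec \<Rightarrow> real vec" where
  "gradient n g z = vec n (\<lambda>k. partial_deriv n k g z)"

definition jacobian :: "nat \<Rightarrow> nat \<Rightarrow> (real vec \<Rightarrow> real vec) \<Rightarrow> real vec \<Rightarrow> real mat" where
  "jacobian p n g z = mat p n (\<lambda>(j, k). partial_deriv n k (\<lambda>z. g z $ j) z)"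


text \<open>Throughout, \<open>f\<close> maps \<open>R\<^sup>m \<times> R\<^sup>n\<close> to \<open>R\<^sup>p\<close>. Full derivatives are taken after identifying
  \<open>R\<^sup>m \<times> R\<^sup>n\<close> with \<open>R\<^sup>(m+n)\<close>.\<close>

type_synonym layer = "real vec \<Rightarrow> real vec \<Rightarrow> real vec"

definition on_pairs :: "nat \<Rightarrow> nat \<Rightarrow> layer \<Rightarrow> real vec \<Rightarrow> real vec" where
  "on_pairs m n f z = f (vec_first z m) (vec_last z n)"

definition jac1 :: "nat \<Rightarrow> nat \<Rightarrow> layer \<Rightarrow> real vec \<Rightarrow> real vec \<Rightarrow> real mat" where
  "jac1 p m f y w = jacobian p m (\<lambda>y. f y w) y"

definition jac2 :: "nat \<Rightarrow> nat \<Rightarrow> layer \<Rightarrow> real vec \<Rightarrow> real vec \<Rightarrow> real mat" where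
  "jac2 p n f y w = jacobian p n (\<lambda>w. f y w) w"

definition hess21 :: "nat \<Rightarrow> nat \<Rightarrow> nat \<Rightarrow> layer \<Rightarrow> real vec \<Rightarrow> real vec \<Rightarrow> tensor" where
  "hess21 p m n f y w j a b = partial_deriv m b (\<lambda>y. jac2 p n f y w $$ (j, a)) y"

definition full_jac :: "nat \<Rightarrow> nat \<Rightarrow> nat \<Rightarrow> layer \<Rightarrow> real vec \<Rightarrow> real vec \<Rightarrow> real mat" where
  "full_jac p m n f y w = jacobian p (m + n) (on_pairs m n f) (y @\<^sub>v w)"

definition full_hess :: "nat \<Rightarrow> nat \<Rightarrow> nat \<Rightarrow> layer \<Rightarrow> real vec \<Rightarrow> real vec \<Rightarrow> tensor" where
  "full_hess p m n f y w j a b =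
     partial_deriv (m + n) b (\<lambda>z. jacobian p (m + n) (on_pairs m n f) z $$ (j, a)) (y @\<^sub>v w)"

definition twice_differentiable :: "nat \<Rightarrow> nat \<Rightarrow> nat \<Rightarrow> layer \<Rightarrow> bool" where
  "twice_differentiable p m n f \<longleftrightarrow>
     (\<forall>z \<in> carrier_vec (m + n). \<forall>j<p.
        frechet_differentiable (m + n) (\<lambda>z. on_pairs m n f z $ j) z \<and>
        (\<forall>a < m + n. frechet_differentiable (m + n)
           (\<lambda>z. jacobian p (m + n) (on_pairs m n f) z $$ (j, a)) z))"

text \<open>Lipschitz continuity with respect to both arguments means in each argument separately,
  the other one being fixed; this is implied by joint Lipschitz continuity with the same constant.\<close>

definition operator_regularity ::
  "nat \<Rightarrow> nat \<Rightarrow> nat \<Rightarrow> layer \<Rightarrow> real \<Rightarrow> real \<Rightarrow> real \<Rightarrow> real \<Rightarrow> real \<Rightarrow> bool" where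
  "operator_regularity p m n f C1 C2 Lf L1 L2 \<longleftrightarrow>
     (\<forall>y \<in> carrier_vec m. \<forall>w \<in> carrier_vec n.
        op_norm (jac1 p m f y w) \<le> C1 \<and> op_norm (jac2 p n f y w) \<le> C1 \<and>
        tensor_op_norm p n m (hess21 p m n f y w) \<le> C2) \<and>
     (\<forall>y \<in> carrier_vec m. \<forall>y' \<in> carrier_vec m. \<forall>w \<in> carrier_vec n.
        vnorm (f y w - f y' w) \<le> Lf * vnorm (y - y') \<and>
        fro_norm (full_jac p m n f y w - full_jac p m n f y' w) \<le> L1 * vnorm (y - y') \<and>
        tensor_fro p (m + n) (m + n)
          (\<lambda>j a b. full_hess p m n f y w j a b - full_hess p m n f y' w j a b)
          \<le> L2 * vnorm (y - y')) \<and>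
     (\<forall>y \<in> carrier_vec m. \<forall>w \<in> carrier_vec n. \<forall>w' \<in> carrier_vec n.
        fro_norm (full_jac p m n f y w - full_jac p m n f y w') \<le> L1 * vnorm (w - w') \<and>
        tensor_fro p (m + n) (m + n)
          (\<lambda>j a b. full_hess p m n f y w j a b - full_hess p m n f y w' j a b)
          \<le> L2 * vnorm (w - w'))"


primrec stack :: "nat \<Rightarrow> (nat \<Rightarrow> real vec) \<Rightarrow> real vec" where
  "stack 0 w = 0\<^sub>v 0"
| "stack (Suc n) w = stack n w @\<^sub>v w (Suc n)"

definition partial_gradient ::
  "nat \<Rightarrow> (nat \<Rightarrow> nat) \<Rightarrow> (real vec \<Rightarrow> real) \<Rightarrow> nat \<Rightarrow> (nat \<Rightarrow> real vec) \<Rightarrow> real vec" where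
  "partial_gradient N dw R i w = gradient (dw i) (\<lambda>z. R (stack N (w(i := z)))) (w i)"


text \<open>One forward and backward pass; \<open>d i\<close> is the dimension of the output of layer \<open>i\<close>
  (\<open>d 0\<close> of the data), \<open>dw i\<close> the one of its weights, and \<open>d N = 1\<close>.\<close>

definition exact_pass ::
  "nat \<Rightarrow> (nat \<Rightarrow> nat) \<Rightarrow> (nat \<Rightarrow> nat) \<Rightarrow> (nat \<Rightarrow> layer) \<Rightarrow> (nat \<Rightarrow> real vec) \<Rightarrow> real vec \<Rightarrow>
   (nat \<Rightarrow> real vec) \<Rightarrow> (nat \<Rightarrow> real vec) \<Rightarrow> (nat \<Rightarrow> real vec) \<Rightarrow> bool" where
  "exact_pass N d dw f w x y v u \<longleftrightarrow>
     y 0 = x \<and>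
     (\<forall>i\<in>{1..N}. y i = f i (y (i - 1)) (w i)) \<and>
     v N = vec 1 (\<lambda>_. 1) \<and>
     (\<forall>i\<in>{2..N}. v (i - 1) =
        transpose_mat (jac1 (d i) (d (i - 1)) (f i) (y (i - 1)) (w i)) *\<^sub>v v i) \<and>
     (\<forall>i\<in>{1..N}. u i = transpose_mat (jac2 (d i) (dw i) (f i) (y (i - 1)) (w i)) *\<^sub>v v i)"

definition perturbed_pass ::
  "nat \<Rightarrow> (nat \<Rightarrow> nat) \<Rightarrow> (nat \<Rightarrow> nat) \<Rightarrow> (nat \<Rightarrow> layer) \<Rightarrow> (nat \<Rightarrow> real vec) \<Rightarrow> real vec \<Rightarrow>
   (nat \<Rightarrow> real vec) \<Rightarrow> (nat \<Rightarrow> real vec) \<Rightarrow>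
   (nat \<Rightarrow> real vec) \<Rightarrow> (nat \<Rightarrow> real vec) \<Rightarrow> (nat \<Rightarrow> real vec) \<Rightarrow> bool" where
  "perturbed_pass N d dw f w x \<delta> \<epsilon> y v u \<longleftrightarrow>
     y 0 = x \<and>
     (\<forall>i\<in>{1..N}. y i = f i (y (i - 1)) (w i) + \<delta> i) \<and>
     v N = vec 1 (\<lambda>_. 1) \<and>
     (\<forall>i\<in>{2..N}. v (i - 1) =
        transpose_mat (jac1 (d i) (d (i - 1)) (f i) (y (i - 1)) (w i)) *\<^sub>v v i + \<epsilon> i) \<and>
     (\<forall>i\<in>{1..N}. u i = transpose_mat (jac2 (d i) (dw i) (f i) (y (i - 1)) (w i)) *\<^sub>v v i)"

definition random_vec :: "'s measure \<Rightarrow> nat \<Rightarrow> ('s \<Rightarrow> real vec) \<Rightarrow> bool" where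
  "random_vec M n X \<longleftrightarrow>
     (\<forall>\<omega> \<in> space M. X \<omega> \<in> carrier_vec n) \<and>
     (\<forall>k<n. (\<lambda>\<omega>. X \<omega> $ k) \<in> borel_measurable M)"


definition C_v :: "nat \<Rightarrow> real \<Rightarrow> real" where
  "C_v N C1 = max 1 (C1 ^ N)"

definition C_delta :: "nat \<Rightarrow> real \<Rightarrow> real \<Rightarrow> real \<Rightarrow> nat \<Rightarrow> real" where
  "C_delta N C1 Lf L1 i =
     4 * (C_v N C1)\<^sup>2 * L1\<^sup>2 *
       (\<Sum>j=i..N-1. (\<Sum>k=0..j. (3 * C1\<^sup>2) ^ k) * (2 * Lf\<^sup>2) ^ (j - i))"

text \<open>The coefficient of the backward perturbation with index \<open>i + 1\<close>.\<close>

definition C_epsilon_Suc :: "real \<Rightarrow> nat \<Rightarrow> real" where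
  "C_epsilon_Suc C1 i = 2 * (\<Sum>j=1..i. (3 * C1\<^sup>2) ^ j)"

end

theory Submission
  imports Defs
begin

text \<open>
  The bound holds pathwise for the squared norms and is then integrated. With \<open>K = C_v\<^sup>2 L1\<^sup>2\<close>,
  the splitting \<open>A\<^sup>T a - B\<^sup>T b = A\<^sup>T (a - b) + (A - B)\<^sup>T b\<close> gives a forward recursion for the
  errors of \<open>y\<close> with factor \<open>2 Lf\<^sup>2\<close> and a backward one for those of \<open>v\<close> with factor
  \<open>p = 3 C1\<^sup>2\<close> and source \<open>3 h\<^sub>j\<close>, where \<open>h\<^sub>j = K |yt\<^sub>j - y\<^sub>j|\<^sup>2 + |\<epsilon>\<^sub>j\<^sub>+\<^sub>1|\<^sup>2\<close>. Summing the
  latter over the layers weights \<open>h\<^sub>j\<close> by \<open>p + \<dots> + p\<^sup>j\<close>; the direct contribution of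
  \<open>yt\<^sub>j - y\<^sub>j\<close> to the error of \<open>u\<^sub>j\<^sub>+\<^sub>1\<close> supplies the missing term \<open>p\<^sup>0\<close> of its weight.
\<close>

section \<open>Euclidean, Frobenius and operator norms\<close>

lemma vnorm_nonneg [simp]: "vnorm v \<ge> 0"
  unfolding vnorm_def by simp

lemma fro_norm_nonneg [simp]: "fro_norm A \<ge> 0"
  unfolding fro_norm_def by simp

lemma vnorm_power2: "(vnorm v)\<^sup>2 = (\<Sum>k<dim_vec v. (v $ k)\<^sup>2)"
  unfolding vnorm_def L2_set_def by (simp add: sum_nonneg)

lemma vnorm_power2_scalar_prod: "(vnorm v)\<^sup>2 = v \<bullet> v"
  unfolding vnorm_power2 scalar_prod_def by (simp add: power2_eq_square lessThan_atLeast0)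

lemma vnorm_smult: "vnorm (c \<cdot>\<^sub>v v) = \<bar>c\<bar> * vnorm v"
  by (simp add: vnorm_def L2_set_def power_mult_distrib real_sqrt_mult flip: sum_distrib_left)

lemma vnorm_triangle:
  assumes "dim_vec a = dim_vec b"
  shows "vnorm (a + b) \<le> vnorm a + vnorm b"
proof -
  have "vnorm (a + b) = L2_set (\<lambda>k. a $ k + b $ k) {..<dim_vec b}"
    unfolding vnorm_def by (intro L2_set_cong) auto
  then show ?thesis
    using L2_set_triangle_ineq[of "\<lambda>k. a $ k" "\<lambda>k. b $ k" "{..<dim_vec b}"] assms
    by (simp add: vnorm_def)
qed

lemma abs_scalar_prod_le_vnorm:
  assumes "dim_vec a = dim_vec b"
  shows "\<bar>a \<bullet> b\<bar> \<le> vnorm a * vnorm b"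
proof -
  have "\<bar>a \<bullet> b\<bar> \<le> (\<Sum>k<dim_vec b. \<bar>a $ k\<bar> * \<bar>b $ k\<bar>)"
    unfolding scalar_prod_def lessThan_atLeast0 abs_mult[symmetric] by (rule sum_abs)
  also have "\<dots> \<le> vnorm a * vnorm b"
    unfolding vnorm_def assms by (rule L2_set_mult_ineq)
  finally show ?thesis .
qed

lemma fro_norm_power2:
  "(fro_norm A)\<^sup>2 = (\<Sum>i<dim_row A. \<Sum>j<dim_col A. (A $$ (i, j))\<^sup>2)"
  unfolding fro_norm_def L2_set_def by (simp add: sum_nonneg sum.cartesian_product)

lemma fro_norm_transpose: "fro_norm (transpose_mat A) = fro_norm A"
proof -
  have "(fro_norm (transpose_mat A))\<^sup>2 = (fro_norm A)\<^sup>2"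
    unfolding fro_norm_power2 by (subst sum.swap) simp
  then show ?thesis by (simp add: power2_eq_iff_nonneg)
qed

text \<open>Cauchy-Schwarz applied to each row. Besides its direct use, this bounds above the set
  whose \<open>Sup\<close> is \<open>op_norm\<close>.\<close>

lemma vnorm_mult_le_fro_norm:
  assumes "x \<in> carrier_vec (dim_col A)"
  shows "vnorm (A *\<^sub>v x) \<le> fro_norm A * vnorm x"
proof (rule power2_le_imp_le)
  have row: "(row A i \<bullet> x)\<^sup>2 \<le> (\<Sum>j<dim_col A. (A $$ (i, j))\<^sup>2) * (vnorm x)\<^sup>2"
    if "i < dim_row A" for i
  proof -
    have "\<bar>row A i \<bullet> x\<bar>\<^sup>2 \<le> (vnorm (row A i) * vnorm x)\<^sup>2"
      using assms by (intro power_mono abs_scalar_prod_le_vnorm) auto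
    then show ?thesis
      using that by (simp add: power_mult_distrib vnorm_power2[of "row A i"])
  qed
  have "(vnorm (A *\<^sub>v x))\<^sup>2 = (\<Sum>i<dim_row A. (row A i \<bullet> x)\<^sup>2)"
    by (simp add: vnorm_power2)
  also have "\<dots> \<le> (\<Sum>i<dim_row A. (\<Sum>j<dim_col A. (A $$ (i, j))\<^sup>2) * (vnorm x)\<^sup>2)"
    using row by (intro sum_mono) auto
  also have "\<dots> = (fro_norm A * vnorm x)\<^sup>2"
    by (simp add: power_mult_distrib fro_norm_power2 sum_distrib_right)
  finally show "(vnorm (A *\<^sub>v x))\<^sup>2 \<le> (fro_norm A * vnorm x)\<^sup>2" .
qed simp

text \<open>A nonzero \<open>x\<close> is scaled to a unit vector, which takes part in the
  \<open>Sup\<close>. For \<open>vnorm x = 0\<close> no scaling exists, and the Frobenius bound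
  makes the left side vanish.\<close>

lemma vnorm_mult_le_op_norm:
  assumes x: "x \<in> carrier_vec (dim_col A)"
  shows "vnorm (A *\<^sub>v x) \<le> op_norm A * vnorm x"
proof (cases "vnorm x = 0")
  case True
  then show ?thesis
    using vnorm_mult_le_fro_norm[OF x] by simp
next
  case False
  define c where "c = vnorm x"
  have c: "c > 0" using False vnorm_nonneg[of x] by (simp add: c_def less_le)
  define e where "e = inverse c \<cdot>\<^sub>v x"
  have e: "e \<in> carrier_vec (dim_col A)" "vnorm e = 1"
    using x c by (auto simp: e_def vnorm_smult c_def[symmetric])
  \<comment> \<open>A real \<open>Sup\<close> is known to dominate the elements only of a set
    bounded above, hence the detour through the Frobenius norm.\<close>
  have "bdd_above {vnorm (A *\<^sub>v x) | x. x \<in> carrier_vec (dim_col A) \<and> vnorm x = 1}"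
    by (rule bdd_aboveI[of _ "fro_norm A"]) (use vnorm_mult_le_fro_norm[of _ A] in fastforce)
  then have "vnorm (A *\<^sub>v e) \<le> op_norm A"
    unfolding op_norm_def using e by (intro cSup_upper) auto
  moreover have "x = c \<cdot>\<^sub>v e"
    using c by (simp add: e_def smult_smult_assoc)
  then have "A *\<^sub>v x = c \<cdot>\<^sub>v (A *\<^sub>v e)"
    using e by (metis carrier_matI mult_mat_vec)
  ultimately show ?thesis
    using c by (simp add: vnorm_smult c_def[symmetric] mult.commute)
qed


text \<open>With \<open>z\<close> the left-hand vector, the squared norm of \<open>z\<close> is the
  scalar product of \<open>v\<close> and \<open>A *\<^sub>v z\<close>, hence at most
  \<open>vnorm v * (c * vnorm z)\<close>; cancelling \<open>vnorm z\<close> avoids computing the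
  operator norm of the transpose. The condition \<open>0 \<le> c\<close> covers the case
  \<open>vnorm z = 0\<close>.\<close>

lemma vnorm_transpose_mult_le:
  assumes v: "v \<in> carrier_vec (dim_row A)" and c: "op_norm A \<le> c" "0 \<le> c"
  shows "vnorm (transpose_mat A *\<^sub>v v) \<le> c * vnorm v"
proof -
  define z where "z = transpose_mat A *\<^sub>v v"
  have z: "z \<in> carrier_vec (dim_col A)" by (simp add: z_def carrier_dim_vec)
  have "z \<bullet> z = v \<bullet> (A *\<^sub>v z)"
    unfolding z_def
    using transpose_vec_mult_scalar[of A "dim_row A" "dim_col A" z v] v z
    by (simp add: z_def)
  then have "(vnorm z)\<^sup>2 \<le> vnorm v * vnorm (A *\<^sub>v z)"
    using abs_scalar_prod_le_vnorm[of v "A *\<^sub>v z"] v by (simp add: vnorm_power2_scalar_prod)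
  also have "\<dots> \<le> vnorm v * (c * vnorm z)"
    using vnorm_mult_le_op_norm[OF z] mult_right_mono[OF c(1), of "vnorm z"]
    by (intro mult_left_mono) auto
  finally have "vnorm z * vnorm z \<le> (c * vnorm v) * vnorm z"
    by (simp add: power2_eq_square mult_ac)
  then have "vnorm z \<le> c * vnorm v"
    using c vnorm_nonneg[of z] by (cases "vnorm z = 0") (simp_all add: less_le)
  then show ?thesis by (simp add: z_def)
qed

lemma vnorm_transpose_mult_le_fro_norm:
  assumes "v \<in> carrier_vec (dim_row A)"
  shows "vnorm (transpose_mat A *\<^sub>v v) \<le> fro_norm A * vnorm v"
  using vnorm_mult_le_fro_norm[of v "transpose_mat A"] assms by (simp add: fro_norm_transpose)

section \<open>Stacked vectors\<close>

lemma vnorm_append_power2: "(vnorm (a @\<^sub>v b))\<^sup>2 = (vnorm a)\<^sup>2 + (vnorm b)\<^sup>2"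
  unfolding vnorm_power2_scalar_prod
  by (rule scalar_prod_append) (auto intro: carrier_vecI)

lemma dim_stack: "dim_vec (stack n a) = (\<Sum>i=1..n. dim_vec (a i))"
  by (induction n) simp_all

text \<open>Equal block dimensions make the entries of the two stacks line up, so subtraction acts
  block by block and Pythagoras applies.\<close>

lemma vnorm_stack_diff_power2:
  assumes "\<And>i. i \<in> {1..n} \<Longrightarrow> dim_vec (a i) = dim_vec (b i)"
  shows "(vnorm (stack n a - stack n b))\<^sup>2 = (\<Sum>i=1..n. (vnorm (a i - b i))\<^sup>2)"
  using assms
proof (induction n)
  case 0
  then show ?case by (simp add: vnorm_power2)
next
  case (Suc n)
  have "dim_vec (stack n a) = dim_vec (stack n b)"
    using Suc.prems by (simp add: dim_stack)
  then have "stack (Suc n) a - stack (Suc n) b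
      = (stack n a - stack n b) @\<^sub>v (a (Suc n) - b (Suc n))"
    using Suc.prems[of "Suc n"] by (intro eq_vecI) auto
  then show ?case
    using Suc by (simp add: vnorm_append_power2)
qed

section \<open>Blocks of the full Jacobian\<close>

lemma vec_first_append_add_unit1:
  fixes y w :: "real vec"
  assumes "k < m" "y \<in> carrier_vec m" "w \<in> carrier_vec n"
  shows "vec_first ((y @\<^sub>v w) + s \<cdot>\<^sub>v unit_vec (m + n) k) m = y + s \<cdot>\<^sub>v unit_vec m k"
    and "vec_last ((y @\<^sub>v w) + s \<cdot>\<^sub>v unit_vec (m + n) k) n = w"
  using assms by (auto intro!: eq_vecI simp: vec_first_def vec_last_def unit_vec_def)

lemma vec_first_append_add_unit2:
  fixes y w :: "real vec"
  assumes "k < n" "y \<in> carrier_vec m" "w \<in> carrier_vec n"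
  shows "vec_first ((y @\<^sub>v w) + s \<cdot>\<^sub>v unit_vec (m + n) (m + k)) m = y"
    and "vec_last ((y @\<^sub>v w) + s \<cdot>\<^sub>v unit_vec (m + n) (m + k)) n = w + s \<cdot>\<^sub>v unit_vec n k"
  using assms by (auto intro!: eq_vecI simp: vec_first_def vec_last_def unit_vec_def)

text \<open>For \<open>k < m\<close> the line in direction \<open>k\<close> through the concatenated
  point moves only the first block, so both entries are \<open>deriv\<close> of the same function of
  \<open>s\<close>.\<close>

lemma full_jac_left:
  assumes "j < p" "k < m" "y \<in> carrier_vec m" "w \<in> carrier_vec n"
  shows "full_jac p m n f y w $$ (j, k) = jac1 p m f y w $$ (j, k)"
  using assms
  by (simp add: full_jac_def jac1_def jacobian_def partial_deriv_def on_pairs_def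
      vec_first_append_add_unit1)

lemma full_jac_right:
  assumes "j < p" "k < n" "y \<in> carrier_vec m" "w \<in> carrier_vec n"
  shows "full_jac p m n f y w $$ (j, m + k) = jac2 p n f y w $$ (j, k)"
  using assms
  by (simp add: full_jac_def jac2_def jacobian_def partial_deriv_def on_pairs_def
      vec_first_append_add_unit2)

lemma dim_jac [simp]:
  "dim_row (jac1 p m f y w) = p" "dim_col (jac1 p m f y w) = m"
  "dim_row (jac2 p n f y w) = p" "dim_col (jac2 p n f y w) = n"
  "dim_row (full_jac p m n f y w) = p" "dim_col (full_jac p m n f y w) = m + n"
  by (simp_all add: jac1_def jac2_def full_jac_def jacobian_def)

lemma sum_lessThan_add: "(\<Sum>k<m + n. g k) = (\<Sum>k<m. g k) + (\<Sum>k<n. g (m + k :: nat))"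
  for g :: "nat \<Rightarrow> real"
  by (induction n) (simp_all add: add.assoc)

lemma fro_norm_full_jac_diff_power2:
  assumes "y \<in> carrier_vec m" "y' \<in> carrier_vec m" "w \<in> carrier_vec n" "w' \<in> carrier_vec n"
  shows "(fro_norm (full_jac p m n f y w - full_jac p m n f y' w'))\<^sup>2
    = (fro_norm (jac1 p m f y w - jac1 p m f y' w'))\<^sup>2
      + (fro_norm (jac2 p n f y w - jac2 p n f y' w'))\<^sup>2"
  using assms
  by (simp add: fro_norm_power2 sum_lessThan_add full_jac_left full_jac_right sum.distrib)

text \<open>The regularity assumption controls the change of the full Jacobian, while the passes use
  its two blocks. The squared Frobenius norm is the sum over the blocks, so each block inherits the
  bound.\<close>

lemma fro_norm_jac_diff_le:
  assumes "y \<in> carrier_vec m" "y' \<in> carrier_vec m" "w \<in> carrier_vec n" "w' \<in> carrier_vec n"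
  shows "fro_norm (jac1 p m f y w - jac1 p m f y' w')
      \<le> fro_norm (full_jac p m n f y w - full_jac p m n f y' w')"
    and "fro_norm (jac2 p n f y w - jac2 p n f y' w')
      \<le> fro_norm (full_jac p m n f y w - full_jac p m n f y' w')"
  using fro_norm_full_jac_diff_power2[OF assms, of p f] by (auto intro: power2_le_imp_le)

section \<open>Differences of backward products\<close>

lemma transpose_mult_diff:
  assumes "A \<in> carrier_mat p n" "B \<in> carrier_mat p n" "a \<in> carrier_vec p" "b \<in> carrier_vec p"
  shows "transpose_mat A *\<^sub>v a - transpose_mat B *\<^sub>v b
    = transpose_mat A *\<^sub>v (a - b) + transpose_mat (A - B) *\<^sub>v (b :: real vec)"
proof -
  have "transpose_mat (A - B) *\<^sub>v b = transpose_mat A *\<^sub>v b - transpose_mat B *\<^sub>v b"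
    using assms by (simp add: minus_mult_distrib_mat_vec[of _ n p] transpose_minus)
  moreover have "transpose_mat A *\<^sub>v (a - b) = transpose_mat A *\<^sub>v a - transpose_mat A *\<^sub>v b"
    using assms by (simp add: mult_minus_distrib_mat_vec[of _ n p])
  ultimately show ?thesis
    using assms by (intro eq_vecI) auto
qed

text \<open>The roles are asymmetric. Later \<open>A\<close> is a Jacobian at the perturbed point
  and \<open>b\<close> the exact backward vector, because it is the exact one whose norm
  \<open>C_v\<close> bounds.\<close>

lemma vnorm_transpose_mult_diff_le:
  assumes "A \<in> carrier_mat p n" "B \<in> carrier_mat p n" "a \<in> carrier_vec p" "b \<in> carrier_vec p"
    and "op_norm A \<le> c" "0 \<le> c" "fro_norm (A - B) \<le> l" "vnorm b \<le> k"
  shows "vnorm (transpose_mat A *\<^sub>v a - transpose_mat B *\<^sub>v b) \<le> c * vnorm (a - b) + l * k"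
proof -
  have "vnorm (transpose_mat A *\<^sub>v a - transpose_mat B *\<^sub>v b)
      \<le> vnorm (transpose_mat A *\<^sub>v (a - b)) + vnorm (transpose_mat (A - B) *\<^sub>v b)"
    unfolding transpose_mult_diff[OF assms(1-4)]
    using assms by (intro vnorm_triangle) auto
  moreover have "vnorm (transpose_mat A *\<^sub>v (a - b)) \<le> c * vnorm (a - b)"
    using assms by (intro vnorm_transpose_mult_le) auto
  moreover have "vnorm (transpose_mat (A - B) *\<^sub>v b) \<le> fro_norm (A - B) * vnorm b"
    using assms by (intro vnorm_transpose_mult_le_fro_norm) auto
  moreover have "fro_norm (A - B) * vnorm b \<le> l * k"
    using assms(7,8) order.trans[OF fro_norm_nonneg assms(7)] by (intro mult_mono) auto
  ultimately show ?thesis by linarith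
qed

section \<open>Scalar inequalities and recursions\<close>

lemma power_le_max_1_power:
  fixes a :: real
  assumes "0 \<le> a" "k \<le> n"
  shows "a ^ k \<le> max 1 (a ^ n)"
proof (cases "a \<le> 1")
  case True
  then show ?thesis using assms by (simp add: power_le_one le_max_iff_disj)
next
  case False
  then show ?thesis using assms by (simp add: power_increasing le_max_iff_disj)
qed

lemma square_add_le:
  fixes a b :: real
  shows "(a + b)\<^sup>2 \<le> 2 * a\<^sup>2 + 2 * b\<^sup>2"
  using zero_le_power2[of "a - b"] by (simp add: power2_eq_square algebra_simps)

lemma square_add3_le:
  fixes a b c :: real
  shows "(a + b + c)\<^sup>2 \<le> 3 * a\<^sup>2 + 3 * b\<^sup>2 + 3 * c\<^sup>2"
  using zero_le_power2[of "a - b"] zero_le_power2[of "a - c"] zero_le_power2[of "b - c"]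
  by (simp add: power2_eq_square algebra_simps)

text \<open>A discrete Gronwall estimate: starting from \<open>a 0 = 0\<close>, the source
  \<open>b k\<close> enters at layer \<open>k\<close> and is multiplied by \<open>q\<close> once for
  each of the \<open>i - k\<close> later layers.\<close>

lemma forward_recursion:
  fixes a b :: "nat \<Rightarrow> real"
  assumes "a 0 = 0" "0 \<le> q" "\<And>i. i \<in> {1..n} \<Longrightarrow> a i \<le> q * a (i - 1) + c * b i" "i \<le> n"
  shows "a i \<le> c * (\<Sum>k=1..i. q ^ (i - k) * b k)"
  using assms(4)
proof (induction i)
  case 0
  then show ?case using assms(1) by simp
next
  case (Suc i)
  have "a (Suc i) \<le> q * a i + c * b (Suc i)"
    using assms(3)[of "Suc i"] Suc.prems by simp
  also have "\<dots> \<le> q * (c * (\<Sum>k=1..i. q ^ (i - k) * b k)) + c * b (Suc i)"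
    using Suc assms(2) by (intro add_right_mono mult_left_mono) auto
  also have "q * (c * (\<Sum>k=1..i. q ^ (i - k) * b k)) = c * (\<Sum>k=1..i. q ^ (Suc i - k) * b k)"
    unfolding sum_distrib_left by (intro sum.cong) (auto simp: Suc_diff_le)
  finally show ?case by (simp add: algebra_simps)
qed

text \<open>A source \<open>h j\<close> reaches every \<open>e i\<close> with
  \<open>i \<le> j\<close>, with weights \<open>p ^ 0\<close> to \<open>p ^ (j - 1)\<close>. The
  extra factor \<open>p\<close> on the left raises these exponents by one, which yields the sums
  occurring in \<open>C_epsilon_Suc\<close> without a division by \<open>p\<close>.\<close>

lemma backward_recursion:
  fixes e h :: "nat \<Rightarrow> real"
  assumes "0 \<le> p" "\<And>j. j \<in> {1..n} \<Longrightarrow> e j \<le> p * e (Suc j) + c * h j"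
  shows "p * (\<Sum>i=1..Suc n. e i)
    \<le> (\<Sum>k=1..Suc n. p ^ k) * e (Suc n) + c * (\<Sum>j=1..n. (\<Sum>k=1..j. p ^ k) * h j)"
  using assms(2)
proof (induction n)
  case 0
  then show ?case by simp
next
  case (Suc n)
  let ?S = "\<lambda>j. \<Sum>k=1..j. p ^ k"
  have S: "?S (Suc (Suc n)) = p + p * ?S (Suc n)"
  proof -
    have "?S (Suc (Suc n)) = p ^ 1 + (\<Sum>k=Suc 1..Suc (Suc n). p ^ k)"
      by (subst sum.atLeast_Suc_atMost) auto
    also have "(\<Sum>k=Suc 1..Suc (Suc n). p ^ k) = (\<Sum>k=1..Suc n. p ^ Suc k)"
      by (rule sum.shift_bounds_cl_Suc_ivl)
    finally show ?thesis by (simp only: sum_distrib_left power_Suc power_one_right)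
  qed
  \<comment> \<open>The induction hypothesis leaves the weight \<open>?S (Suc n)\<close> on its last
    error, and the recursion pushes it one layer further. Together with the new summand
    \<open>p * e (Suc (Suc n))\<close> it becomes \<open>?S (Suc (Suc n))\<close> by
    \<open>S\<close>.\<close>
  have "?S (Suc n) * e (Suc n) \<le> ?S (Suc n) * (p * e (Suc (Suc n)) + c * h (Suc n))"
    using Suc.prems[of "Suc n"] assms(1) by (intro mult_left_mono sum_nonneg) auto
  moreover have "p * (\<Sum>i=1..Suc n. e i) \<le> ?S (Suc n) * e (Suc n) + c * (\<Sum>j=1..n. ?S j * h j)"
    using Suc.prems by (intro Suc.IH) auto
  moreover have "p * (\<Sum>i=1..Suc (Suc n). e i) = p * (\<Sum>i=1..Suc n. e i) + p * e (Suc (Suc n))"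
    by (simp add: distrib_left)
  moreover have "(\<Sum>j=1..Suc n. ?S j * h j) = (\<Sum>j=1..n. ?S j * h j) + ?S (Suc n) * h (Suc n)"
    by simp
  ultimately show ?case
    unfolding S by (simp only: distrib_left distrib_right mult_ac)
qed

lemma sum_triangle_swap:
  fixes g :: "nat \<Rightarrow> nat \<Rightarrow> real"
  shows "(\<Sum>j=1..n. \<Sum>i=1..j. g i j) = (\<Sum>i=1..n. \<Sum>j=i..n. g i j)"
proof -
  have "(\<Sum>j=1..n. \<Sum>i=1..j. g i j) = (\<Sum>j\<in>{1..n}. \<Sum>i | i \<in> {1..n} \<and> i \<le> j. g i j)"
    by (intro sum.cong refl) auto
  also have "\<dots> = (\<Sum>i\<in>{1..n}. \<Sum>j | j \<in> {1..n} \<and> i \<le> j. g i j)"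
    by (intro sum.swap_restrict) auto
  also have "\<dots> = (\<Sum>i=1..n. \<Sum>j=i..n. g i j)"
    by (intro sum.cong refl) auto
  finally show ?thesis .
qed

text \<open>
  Here \<open>a\<close>, \<open>e\<close>, \<open>U\<close> are the squared errors of \<open>y\<close>, \<open>v\<close>, \<open>u\<close> and \<open>b\<close>, \<open>g\<close> the squared
  perturbations.
\<close>

lemma error_propagation:
  fixes a b e g U :: "nat \<Rightarrow> real"
  assumes N: "N \<ge> 1" and K: "K \<ge> 0"
    and a0: "a 0 = 0" and eN: "e N = 0"
    and a: "\<And>i. i \<in> {1..N} \<Longrightarrow> a i \<le> 2 * Lf\<^sup>2 * a (i - 1) + 2 * b i"
    and e: "\<And>i. i \<in> {2..N} \<Longrightarrow> e (i - 1) \<le> 3 * C1\<^sup>2 * e i + 3 * K * a (i - 1) + 3 * g i"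
    and U: "\<And>i. i \<in> {1..N} \<Longrightarrow> U i \<le> 2 * C1\<^sup>2 * e i + 2 * K * a (i - 1)"
  shows "(\<Sum>i=1..N. U i)
    \<le> (\<Sum>i=1..N-1. 4 * K * (\<Sum>j=i..N-1. (\<Sum>k=0..j. (3 * C1\<^sup>2) ^ k) * (2 * Lf\<^sup>2) ^ (j - i)) * b i)
      + (\<Sum>i=1..N-1. C_epsilon_Suc C1 i * g (i + 1))"
proof -
  define p where "p = 3 * C1\<^sup>2"
  define q where "q = 2 * Lf\<^sup>2"
  define S where "S j = (\<Sum>k=1..j. p ^ k)" for j
  obtain n where n: "N = Suc n" using N by (cases N) auto
  \<comment> \<open>The bound on \<open>e j\<close> is the hypothesis at \<open>i = j + 1\<close>,
    so its source carries \<open>a j\<close> but \<open>g (j + 1)\<close>.\<close>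
  have "p * (\<Sum>i=1..Suc n. e i)
    \<le> S (Suc n) * e (Suc n) + 3 * (\<Sum>j=1..n. S j * (K * a j + g (j + 1)))"
    unfolding S_def
  proof (rule backward_recursion)
    show "e j \<le> p * e (Suc j) + 3 * (K * a j + g (j + 1))" if "j \<in> {1..n}" for j
      using e[of "Suc j"] that n by (simp add: p_def algebra_simps)
  qed (simp add: p_def)
  then have pe: "p * (\<Sum>i=1..N. e i) \<le> 3 * (\<Sum>j=1..n. S j * (K * a j + g (j + 1)))"
    using eN n by simp
  \<comment> \<open>The Jacobians are evaluated at the outputs 0 to \<open>N - 1\<close>. Output 0
    carries no error and output \<open>N\<close> does not occur, which is why the bound has no term
    for the last forward perturbation.\<close>
  have shift: "(\<Sum>i=1..N. a (i - 1)) = (\<Sum>j=1..n. a j)"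
  proof -
    have "(\<Sum>i=1..N. a (i - 1)) = (\<Sum>j=0..n. a j)"
      unfolding n using sum.shift_bounds_cl_Suc_ivl[of "\<lambda>i. a (i - 1)" 0 n] by simp
    then show ?thesis using a0 by (simp add: sum.atLeast_Suc_atMost)
  qed
  have T: "(\<Sum>k=0..j. p ^ k) = 1 + S j" for j
    by (simp add: S_def sum.atLeast_Suc_atMost)
  have Sn: "S j \<ge> 0" for j
    by (simp add: S_def p_def sum_nonneg)
  have "(\<Sum>i=1..N. U i) \<le> (\<Sum>i=1..N. 2 * C1\<^sup>2 * e i + 2 * K * a (i - 1))"
    by (intro sum_mono U)
  \<comment> \<open>As \<open>2 * C1\<^sup>2 = 2 / 3 * p\<close>, the factor 3 of the backward
    sources turns into the factor 2 of \<open>C_epsilon_Suc\<close>.\<close>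
  also have "\<dots> = 2 / 3 * (p * (\<Sum>i=1..N. e i)) + 2 * K * (\<Sum>j=1..n. a j)"
    unfolding shift[symmetric] by (simp add: sum.distrib sum_distrib_left p_def mult_ac)
  also have "\<dots> \<le> 2 * (\<Sum>j=1..n. S j * (K * a j + g (j + 1))) + 2 * K * (\<Sum>j=1..n. a j)"
    using pe by simp
  also have "\<dots> = (\<Sum>j=1..n. 2 * K * (1 + S j) * a j) + (\<Sum>j=1..n. 2 * S j * g (j + 1))"
    by (simp add: sum_distrib_left flip: sum.distrib) (simp add: algebra_simps)
  \<comment> \<open>The forward errors are replaced by their sources. The factor 2 in front of those
    and the one already present give the 4 of the forward coefficients.\<close>
  also have "(\<Sum>j=1..n. 2 * K * (1 + S j) * a j)
      \<le> (\<Sum>j=1..n. 2 * K * (1 + S j) * (2 * (\<Sum>i=1..j. q ^ (j - i) * b i)))"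
  proof (intro sum_mono mult_left_mono)
    fix j assume "j \<in> {1..n}"
    then show "a j \<le> 2 * (\<Sum>i=1..j. q ^ (j - i) * b i)"
      using a n by (intro forward_recursion[where n = N] a0) (auto simp: q_def)
  qed (use K Sn in auto)
  also have "\<dots> = (\<Sum>j=1..n. \<Sum>i=1..j. 4 * K * ((1 + S j) * q ^ (j - i)) * b i)"
    unfolding sum_distrib_left by (intro sum.cong) simp_all
  \<comment> \<open>Exchanging the sums collects the coefficient of each \<open>b i\<close>, with
    \<open>j\<close> running over the outputs which that perturbation reaches.\<close>
  also have "\<dots> = (\<Sum>i=1..n. \<Sum>j=i..n. 4 * K * ((1 + S j) * q ^ (j - i)) * b i)"
    by (rule sum_triangle_swap)
  also have "\<dots> = (\<Sum>i=1..n. 4 * K * (\<Sum>j=i..n. (1 + S j) * q ^ (j - i)) * b i)"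
    by (simp add: sum_distrib_left sum_distrib_right)
  finally show ?thesis
    by (simp only: n diff_Suc_1 C_epsilon_Suc_def T S_def p_def[symmetric] q_def[symmetric])
qed

section \<open>Dimensions and size of the vectors in a pass\<close>

lemma exact_passD:
  assumes "exact_pass N d dw f w x y v u"
  shows "y 0 = x" "v N = vec 1 (\<lambda>_. 1)"
    and "i \<in> {1..N} \<Longrightarrow> y i = f i (y (i - 1)) (w i)"
    and "i \<in> {2..N} \<Longrightarrow> v (i - 1) =
      transpose_mat (jac1 (d i) (d (i - 1)) (f i) (y (i - 1)) (w i)) *\<^sub>v v i"
    and "i \<in> {1..N} \<Longrightarrow>
      u i = transpose_mat (jac2 (d i) (dw i) (f i) (y (i - 1)) (w i)) *\<^sub>v v i"
  using assms by (simp_all only: exact_pass_def)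

lemma perturbed_passD:
  assumes "perturbed_pass N d dw f w x \<delta> \<epsilon> y v u"
  shows "y 0 = x" "v N = vec 1 (\<lambda>_. 1)"
    and "i \<in> {1..N} \<Longrightarrow> y i = f i (y (i - 1)) (w i) + \<delta> i"
    and "i \<in> {2..N} \<Longrightarrow> v (i - 1) =
      transpose_mat (jac1 (d i) (d (i - 1)) (f i) (y (i - 1)) (w i)) *\<^sub>v v i + \<epsilon> i"
    and "i \<in> {1..N} \<Longrightarrow>
      u i = transpose_mat (jac2 (d i) (dw i) (f i) (y (i - 1)) (w i)) *\<^sub>v v i"
  using assms by (simp_all only: perturbed_pass_def)

text \<open>The outputs \<open>y\<close> need an induction, since \<open>f i\<close> is controlled
  only on arguments of the right dimension. Below the last layer \<open>v\<close> gets its dimension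
  from the transposed Jacobian, and so does every \<open>u\<close>.\<close>

lemma exact_pass_carrier:
  assumes pass: "exact_pass N d dw f w x y v u" and dN: "d N = 1" and x: "x \<in> carrier_vec (d 0)"
    and f: "\<And>i a b. i \<in> {1..N} \<Longrightarrow> a \<in> carrier_vec (d (i - 1)) \<Longrightarrow> b \<in> carrier_vec (dw i) \<Longrightarrow>
           f i a b \<in> carrier_vec (d i)"
    and w: "\<And>i. i \<in> {1..N} \<Longrightarrow> w i \<in> carrier_vec (dw i)"
  shows "i \<le> N \<Longrightarrow> y i \<in> carrier_vec (d i)"
    and "i \<in> {1..N} \<Longrightarrow> v i \<in> carrier_vec (d i)"
    and "i \<in> {1..N} \<Longrightarrow> dim_vec (u i) = dw i"
proof -
  show "i \<le> N \<Longrightarrow> y i \<in> carrier_vec (d i)"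
  proof (induction i)
    case 0
    then show ?case using x by (simp add: exact_passD(1)[OF pass])
  next
    case (Suc i)
    then show ?case
      using exact_passD(3)[OF pass, of "Suc i"] f[of "Suc i" "y i"] w[of "Suc i"] by simp
  qed
  show "v i \<in> carrier_vec (d i)" if "i \<in> {1..N}"
  proof (cases "i = N")
    case True
    show ?thesis unfolding True exact_passD(2)[OF pass] dN by (rule vec_carrier)
  next
    case False
    then have "Suc i \<in> {2..N}" using that by simp
    then have "v (Suc i - 1) = transpose_mat (jac1 (d (Suc i)) (d (Suc i - 1)) (f (Suc i))
        (y (Suc i - 1)) (w (Suc i))) *\<^sub>v v (Suc i)"
      by (rule exact_passD(4)[OF pass])
    then show ?thesis by (simp add: carrier_dim_vec)
  qed
  show "i \<in> {1..N} \<Longrightarrow> dim_vec (u i) = dw i"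
    using exact_passD(5)[OF pass, of i] by simp
qed

text \<open>Vector addition takes the dimension of its right summand, so apart from the initial
  values the dimensions of \<open>y\<close> and \<open>v\<close> are those of the perturbations,
  without induction.\<close>

lemma perturbed_pass_carrier:
  assumes pass: "perturbed_pass N d dw f w x \<delta> \<epsilon> y v u"
    and dN: "d N = 1" and x: "x \<in> carrier_vec (d 0)"
    and \<delta>: "\<And>i. i \<in> {1..N} \<Longrightarrow> \<delta> i \<in> carrier_vec (d i)"
    and \<epsilon>: "\<And>i. i \<in> {2..N} \<Longrightarrow> \<epsilon> i \<in> carrier_vec (d (i - 1))"
  shows "i \<le> N \<Longrightarrow> y i \<in> carrier_vec (d i)"
    and "i \<in> {1..N} \<Longrightarrow> v i \<in> carrier_vec (d i)"
    and "i \<in> {1..N} \<Longrightarrow> dim_vec (u i) = dw i"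
proof -
  show "y i \<in> carrier_vec (d i)" if "i \<le> N"
  proof (cases "i = 0")
    case True
    then show ?thesis using x by (simp add: perturbed_passD(1)[OF pass])
  next
    case False
    then have i: "i \<in> {1..N}" using that by simp
    show ?thesis
      unfolding perturbed_passD(3)[OF pass i] using \<delta>[OF i] by (intro carrier_vecI) simp
  qed
  show "v i \<in> carrier_vec (d i)" if "i \<in> {1..N}"
  proof (cases "i = N")
    case True
    show ?thesis unfolding True perturbed_passD(2)[OF pass] dN by (rule vec_carrier)
  next
    case False
    then have i: "Suc i \<in> {2..N}" using that by simp
    then have "v (Suc i - 1) = transpose_mat (jac1 (d (Suc i)) (d (Suc i - 1)) (f (Suc i))
        (y (Suc i - 1)) (w (Suc i))) *\<^sub>v v (Suc i) + \<epsilon> (Suc i)"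
      by (rule perturbed_passD(4)[OF pass])
    then show ?thesis using \<epsilon>[OF i] by (intro carrier_vecI) simp
  qed
  show "i \<in> {1..N} \<Longrightarrow> dim_vec (u i) = dw i"
    using perturbed_passD(5)[OF pass, of i] by simp
qed

text \<open>Going back from the output, \<open>v\<close> starts with norm 1 and each layer
  multiplies the norm by at most \<open>C1\<close>. After \<open>N - i\<close> layers,
  \<open>C_v\<close> dominates the power whether \<open>C1\<close> is below or above 1.\<close>

lemma vnorm_exact_v_le:
  assumes pass: "exact_pass N d dw f w x y v u" and dN: "d N = 1"
    and C1: "0 \<le> C1"
    and op: "\<And>i. i \<in> {1..N} \<Longrightarrow> op_norm (jac1 (d i) (d (i - 1)) (f i) (y (i - 1)) (w i)) \<le> C1"
    and v: "\<And>i. i \<in> {1..N} \<Longrightarrow> v i \<in> carrier_vec (d i)"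
    and i: "i \<in> {1..N}"
  shows "vnorm (v i) \<le> C_v N C1"
proof -
  have "vnorm (v (N - k)) \<le> C1 ^ k" if "k < N" for k
    using that
  proof (induction k)
    case 0
    then show ?case using pass by (simp add: exact_pass_def vnorm_def L2_set_def)
  next
    case (Suc k)
    define j where "j = N - k"
    have j: "j \<in> {2..N}" "N - Suc k = j - 1" using Suc.prems by (auto simp: j_def)
    have "v (j - 1) = transpose_mat (jac1 (d j) (d (j - 1)) (f j) (y (j - 1)) (w j)) *\<^sub>v v j"
      using pass j unfolding exact_pass_def by blast
    then have "vnorm (v (j - 1)) \<le> C1 * vnorm (v j)"
      using v[of j] op[of j] j C1 by (simp add: vnorm_transpose_mult_le)
    also have "\<dots> \<le> C1 * C1 ^ k"
      using Suc C1 by (intro mult_left_mono) (auto simp: j_def)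
    finally show ?case by (simp add: j(2))
  qed
  from this[of "N - i"] show ?thesis
    using i C1 power_le_max_1_power[of C1 "N - i" N] by (simp add: C_v_def)
qed

section \<open>Pathwise error bound\<close>

lemma add_diff_rearrange:
  fixes a b c :: "real vec"
  assumes "a \<in> carrier_vec n" "b \<in> carrier_vec n" "c \<in> carrier_vec n"
  shows "a + c - b = (a - b) + c"
  using assms by (intro eq_vecI) auto

lemma vnorm_add_diff_le:
  assumes "a \<in> carrier_vec n" "b \<in> carrier_vec n" "c \<in> carrier_vec n"
  shows "vnorm (a + c - b) \<le> vnorm (a - b) + vnorm c"
  using vnorm_triangle[of "a - b" c] assms by (simp add: add_diff_rearrange[OF assms])

lemma pathwise_error_bound:
  assumes N: "N \<ge> 1" and dN: "d N = 1" and C: "C1 \<ge> 0" "L1 \<ge> 0" "Lf \<ge> 0"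
    and f: "\<And>i a b. i \<in> {1..N} \<Longrightarrow> a \<in> carrier_vec (d (i - 1)) \<Longrightarrow> b \<in> carrier_vec (dw i) \<Longrightarrow>
           f i a b \<in> carrier_vec (d i)"
    and reg: "\<And>i. i \<in> {1..N} \<Longrightarrow>
           operator_regularity (d i) (d (i - 1)) (dw i) (f i) C1 C2 Lf L1 L2"
    and w: "\<And>i. i \<in> {1..N} \<Longrightarrow> w i \<in> carrier_vec (dw i)"
    and x: "x \<in> carrier_vec (d 0)"
    and \<delta>: "\<And>i. i \<in> {1..N} \<Longrightarrow> \<delta> i \<in> carrier_vec (d i)"
    and \<epsilon>: "\<And>i. i \<in> {2..N} \<Longrightarrow> \<epsilon> i \<in> carrier_vec (d (i - 1))"
    and pert: "perturbed_pass N d dw f w x \<delta> \<epsilon> yt vt ut"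
    and exact: "exact_pass N d dw f w x y v u"
  shows "(vnorm (stack N ut - stack N u))\<^sup>2
    \<le> (\<Sum>i=1..N-1. C_delta N C1 Lf L1 i * (vnorm (\<delta> i))\<^sup>2)
      + (\<Sum>i=1..N-1. C_epsilon_Suc C1 i * (vnorm (\<epsilon> (i + 1)))\<^sup>2)"
proof -
  have ec: "\<And>i. i \<le> N \<Longrightarrow> y i \<in> carrier_vec (d i)"
    "\<And>i. i \<in> {1..N} \<Longrightarrow> v i \<in> carrier_vec (d i)"
    "\<And>i. i \<in> {1..N} \<Longrightarrow> dim_vec (u i) = dw i"
    by (rule exact_pass_carrier[OF exact dN x]; use f w in blast)+
  have pc: "\<And>i. i \<le> N \<Longrightarrow> yt i \<in> carrier_vec (d i)"
    "\<And>i. i \<in> {1..N} \<Longrightarrow> vt i \<in> carrier_vec (d i)"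
    "\<And>i. i \<in> {1..N} \<Longrightarrow> dim_vec (ut i) = dw i"
    by (rule perturbed_pass_carrier[OF pert dN x]; use \<delta> \<epsilon> in blast)+
  define cv where "cv = C_v N C1"
  define J1t where "J1t i = jac1 (d i) (d (i - 1)) (f i) (yt (i - 1)) (w i)" for i
  define J1 where "J1 i = jac1 (d i) (d (i - 1)) (f i) (y (i - 1)) (w i)" for i
  define J2t where "J2t i = jac2 (d i) (dw i) (f i) (yt (i - 1)) (w i)" for i
  define J2 where "J2 i = jac2 (d i) (dw i) (f i) (y (i - 1)) (w i)" for i
  define ey where "ey i = vnorm (yt i - y i)" for i
  define ev where "ev i = vnorm (vt i - v i)" for i
  have carr: "J1t i \<in> carrier_mat (d i) (d (i - 1))" "J1 i \<in> carrier_mat (d i) (d (i - 1))"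
    "J2t i \<in> carrier_mat (d i) (dw i)" "J2 i \<in> carrier_mat (d i) (dw i)" for i
    by (auto simp: J1t_def J1_def J2t_def J2_def intro: carrier_matI)
  have yc: "y (i - 1) \<in> carrier_vec (d (i - 1))" "yt (i - 1) \<in> carrier_vec (d (i - 1))"
    if "i \<in> {1..N}" for i
    using that by (auto intro: ec(1) pc(1))
  \<comment> \<open>The bound on \<open>J1\<close> serves to bound the exact \<open>v\<close>;
    \<open>J1t\<close> and \<open>J2t\<close> multiply the error of \<open>v\<close> in the
    splitting.\<close>
  have op: "op_norm (J1 i) \<le> C1" "op_norm (J1t i) \<le> C1" "op_norm (J2t i) \<le> C1"
    if i: "i \<in> {1..N}" for i
    using reg[OF i] yc[OF i] w[OF i]
    unfolding operator_regularity_def J1_def J1t_def J2t_def by blast+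
  have lip: "vnorm (f i (yt (i - 1)) (w i) - f i (y (i - 1)) (w i)) \<le> Lf * ey (i - 1)"
    if i: "i \<in> {1..N}" for i
    using reg[OF i] yc[OF i] w[OF i] unfolding operator_regularity_def ey_def by blast
  have fro: "fro_norm (J1t i - J1 i) \<le> L1 * ey (i - 1)" "fro_norm (J2t i - J2 i) \<le> L1 * ey (i - 1)"
    if i: "i \<in> {1..N}" for i
  proof -
    \<comment> \<open>Both passes use the same weights, so the Jacobians differ only through their
      first argument.\<close>
    have full: "fro_norm (full_jac (d i) (d (i - 1)) (dw i) (f i) (yt (i - 1)) (w i)
        - full_jac (d i) (d (i - 1)) (dw i) (f i) (y (i - 1)) (w i)) \<le> L1 * ey (i - 1)"
      using reg[OF i] yc[OF i] w[OF i] unfolding operator_regularity_def ey_def by blast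
    show "fro_norm (J1t i - J1 i) \<le> L1 * ey (i - 1)" "fro_norm (J2t i - J2 i) \<le> L1 * ey (i - 1)"
      using fro_norm_jac_diff_le[OF yc(2)[OF i] yc(1)[OF i] w[OF i] w[OF i]] full
      unfolding J1_def J1t_def J2_def J2t_def by (meson order.trans)+
  qed
  have vb: "vnorm (v i) \<le> cv" if "i \<in> {1..N}" for i
    unfolding cv_def using that op(1) ec(2)
    by (intro vnorm_exact_v_le[OF exact dN C(1)]) (auto simp: J1_def)
  have "(vnorm (stack N ut - stack N u))\<^sup>2 = (\<Sum>i=1..N. (vnorm (ut i - u i))\<^sup>2)"
    by (intro vnorm_stack_diff_power2) (simp add: ec(3) pc(3))
  also have "\<dots> \<le> (\<Sum>i=1..N-1. 4 * (cv\<^sup>2 * L1\<^sup>2) *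
        (\<Sum>j=i..N-1. (\<Sum>k=0..j. (3 * C1\<^sup>2) ^ k) * (2 * Lf\<^sup>2) ^ (j - i)) * (vnorm (\<delta> i))\<^sup>2)
      + (\<Sum>i=1..N-1. C_epsilon_Suc C1 i * (vnorm (\<epsilon> (i + 1)))\<^sup>2)"
  \<comment> \<open>The constant \<open>K\<close> is \<open>cv\<^sup>2 * L1\<^sup>2\<close>: the
    exact backward vectors have norm at most \<open>cv\<close>, and the Jacobians of layer
    \<open>i\<close> differ by at most \<open>L1 * ey (i - 1)\<close>.\<close>
  proof (rule error_propagation[OF N, where a = "\<lambda>i. (ey i)\<^sup>2" and e = "\<lambda>i. (ev i)\<^sup>2"
        and g = "\<lambda>i. (vnorm (\<epsilon> i))\<^sup>2"])
    \<comment> \<open>Both passes start from the same data and the same terminal backward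
      vector.\<close>
    show "(ey 0)\<^sup>2 = 0" "(ev N)\<^sup>2 = 0"
      using pert exact
      by (simp_all add: ey_def ev_def exact_pass_def perturbed_pass_def vnorm_def L2_set_def)
    show "(ey i)\<^sup>2 \<le> 2 * Lf\<^sup>2 * (ey (i - 1))\<^sup>2 + 2 * (vnorm (\<delta> i))\<^sup>2" if i: "i \<in> {1..N}" for i
    proof -
      have "ey i = vnorm (f i (yt (i - 1)) (w i) + \<delta> i - f i (y (i - 1)) (w i))"
        using pert exact i by (simp add: ey_def exact_pass_def perturbed_pass_def)
      also have "\<dots> \<le> vnorm (f i (yt (i - 1)) (w i) - f i (y (i - 1)) (w i)) + vnorm (\<delta> i)"
        by (rule vnorm_add_diff_le[OF f f \<delta>]) (use i yc w in auto)
      also have "\<dots> \<le> Lf * ey (i - 1) + vnorm (\<delta> i)"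
        using lip[OF i] by simp
      finally have "(ey i)\<^sup>2 \<le> (Lf * ey (i - 1) + vnorm (\<delta> i))\<^sup>2"
        by (simp add: ey_def power_mono)
      also have "\<dots> \<le> 2 * (Lf * ey (i - 1))\<^sup>2 + 2 * (vnorm (\<delta> i))\<^sup>2"
        by (rule square_add_le)
      finally show ?thesis by (simp add: power_mult_distrib)
    qed
    show "(ev (i - 1))\<^sup>2 \<le> 3 * C1\<^sup>2 * (ev i)\<^sup>2 + 3 * (cv\<^sup>2 * L1\<^sup>2) * (ey (i - 1))\<^sup>2
        + 3 * (vnorm (\<epsilon> i))\<^sup>2" if i: "i \<in> {2..N}" for i
    proof -
      have i1: "i \<in> {1..N}" using i by auto
      have "ev (i - 1)
          = vnorm (transpose_mat (J1t i) *\<^sub>v vt i + \<epsilon> i - transpose_mat (J1 i) *\<^sub>v v i)"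
        using pert exact i by (simp add: ev_def exact_pass_def perturbed_pass_def J1_def J1t_def)
      also have "\<dots> \<le> vnorm (transpose_mat (J1t i) *\<^sub>v vt i - transpose_mat (J1 i) *\<^sub>v v i)
          + vnorm (\<epsilon> i)"
        by (rule vnorm_add_diff_le[OF _ _ \<epsilon>[OF i]]) (use carr[of i] in \<open>auto simp: carrier_dim_vec\<close>)
      also have "\<dots> \<le> C1 * ev i + L1 * ey (i - 1) * cv + vnorm (\<epsilon> i)"
        using vnorm_transpose_mult_diff_le[OF carr(1,2) pc(2) ec(2) op(2) C(1) fro(1) vb] i1
        by (simp add: ev_def)
      finally have "(ev (i - 1))\<^sup>2 \<le> (C1 * ev i + L1 * ey (i - 1) * cv + vnorm (\<epsilon> i))\<^sup>2"
        by (simp add: ev_def power_mono)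
      \<comment> \<open>Squaring costs the number of summands: here the propagated error, the change
        of the Jacobian and the fresh perturbation, against two summands in the bounds for
        \<open>y\<close> and \<open>u\<close>.\<close>
      also have "\<dots> \<le> 3 * (C1 * ev i)\<^sup>2 + 3 * (L1 * ey (i - 1) * cv)\<^sup>2 + 3 * (vnorm (\<epsilon> i))\<^sup>2"
        by (rule square_add3_le)
      finally show ?thesis by (simp add: power_mult_distrib mult_ac)
    qed
    show "(vnorm (ut i - u i))\<^sup>2 \<le> 2 * C1\<^sup>2 * (ev i)\<^sup>2 + 2 * (cv\<^sup>2 * L1\<^sup>2) * (ey (i - 1))\<^sup>2"
      if i: "i \<in> {1..N}" for i
    proof -
      have "vnorm (ut i - u i)
          = vnorm (transpose_mat (J2t i) *\<^sub>v vt i - transpose_mat (J2 i) *\<^sub>v v i)"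
        using pert exact i by (simp add: exact_pass_def perturbed_pass_def J2_def J2t_def)
      also have "\<dots> \<le> C1 * ev i + L1 * ey (i - 1) * cv"
        using vnorm_transpose_mult_diff_le[OF carr(3,4) pc(2) ec(2) op(3) C(1) fro(2) vb] i
        by (simp add: ev_def)
      finally have "(vnorm (ut i - u i))\<^sup>2 \<le> (C1 * ev i + L1 * ey (i - 1) * cv)\<^sup>2"
        by (simp add: power_mono)
      also have "\<dots> \<le> 2 * (C1 * ev i)\<^sup>2 + 2 * (L1 * ey (i - 1) * cv)\<^sup>2"
        by (rule square_add_le)
      finally show ?thesis by (simp add: power_mult_distrib mult_ac)
    qed
  qed simp
  finally show ?thesis by (simp add: C_delta_def cv_def mult.assoc)
qed

section \<open>Measurability and expectations\<close>

lemma C_delta_nonneg: "C_delta N C1 Lf L1 i \<ge> 0"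
  unfolding C_delta_def by (simp add: sum_nonneg)

lemma C_epsilon_Suc_nonneg: "C_epsilon_Suc C1 i \<ge> 0"
  unfolding C_epsilon_Suc_def by (simp add: sum_nonneg)

text \<open>Measurability of a random vector is given by coordinates. On \<open>space M\<close> the
  dimension is constantly \<open>n\<close>, so the squared norm is there a fixed finite sum of
  measurable functions.\<close>

lemma random_vec_vnorm_measurable:
  assumes "random_vec M n X"
  shows "(\<lambda>\<omega>. (vnorm (X \<omega>))\<^sup>2) \<in> borel_measurable M"
proof -
  have "(\<lambda>\<omega>. \<Sum>k<n. (X \<omega> $ k)\<^sup>2) \<in> borel_measurable M"
    using assms by (intro borel_measurable_sum borel_measurable_power) (simp add: random_vec_def)
  moreover have "(vnorm (X \<omega>))\<^sup>2 = (\<Sum>k<n. (X \<omega> $ k)\<^sup>2)" if "\<omega> \<in> space M" for \<omega>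
    using assms that by (auto simp: random_vec_def vnorm_power2)
  ultimately show ?thesis
    by (subst measurable_cong)
qed

text \<open>Expectations are nonnegative integrals in \<open>ennreal\<close>, so the inequality
  keeps its meaning when a second moment is infinite.\<close>

theorem theorem1:
  fixes N T :: nat and d dw :: "nat \<Rightarrow> nat"
    and f :: "nat \<Rightarrow> layer" and R :: "real vec \<Rightarrow> real"
    and C1 C2 Lf L1 L2 \<gamma> :: real
    and M :: "'s measure"
    and x :: "nat \<Rightarrow> 's \<Rightarrow> real vec"
    and w \<delta> \<epsilon> y v u yt vt ut :: "nat \<Rightarrow> nat \<Rightarrow> 's \<Rightarrow> real vec"
  assumes "N \<ge> 2"
    and "\<And>i. i < N \<Longrightarrow> d i > 0" and "d N = 1"
    and "\<And>i. i \<in> {1..N} \<Longrightarrow> dw i > 0"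
    and "\<And>i a b. i \<in> {1..N} \<Longrightarrow> a \<in> carrier_vec (d (i - 1)) \<Longrightarrow> b \<in> carrier_vec (dw i) \<Longrightarrow>
           f i a b \<in> carrier_vec (d i)"
    and "\<And>i. i \<in> {1..N} \<Longrightarrow> twice_differentiable (d i) (d (i - 1)) (dw i) (f i)"
    and "\<And>z. z \<in> carrier_vec (\<Sum>i=1..N. dw i) \<Longrightarrow>
           frechet_differentiable (\<Sum>i=1..N. dw i) R z"
    and "C1 > 0" "C2 > 0" "Lf > 0" "L1 > 0" "L2 > 0"
    and "\<And>i. i \<in> {1..N} \<Longrightarrow>
           operator_regularity (d i) (d (i - 1)) (dw i) (f i) C1 C2 Lf L1 L2"
    and "prob_space M" and "\<gamma> > 0"
    and "\<And>i. i \<in> {1..N} \<Longrightarrow> random_vec M (dw i) (w 1 i)"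
    and "\<And>t. t \<in> {1..T} \<Longrightarrow> random_vec M (d 0) (x t)"
    and "\<And>t i. t \<in> {1..T} \<Longrightarrow> i \<in> {1..N} \<Longrightarrow> random_vec M (d i) (\<delta> t i)"
    and "\<And>t i. t \<in> {1..T} \<Longrightarrow> i \<in> {2..N} \<Longrightarrow> random_vec M (d (i - 1)) (\<epsilon> t i)"
    and "\<And>t \<omega>. t \<in> {1..T} \<Longrightarrow> \<omega> \<in> space M \<Longrightarrow>
           perturbed_pass N d dw f (\<lambda>i. w t i \<omega>) (x t \<omega>) (\<lambda>i. \<delta> t i \<omega>) (\<lambda>i. \<epsilon> t i \<omega>)
             (\<lambda>i. yt t i \<omega>) (\<lambda>i. vt t i \<omega>) (\<lambda>i. ut t i \<omega>)"
    and "\<And>t i \<omega>. t \<in> {1..T} \<Longrightarrow> i \<in> {1..N} \<Longrightarrow> \<omega> \<in> space M \<Longrightarrow>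
           w (t + 1) i \<omega> =
             w t i \<omega> - \<gamma> \<cdot>\<^sub>v (ut t i \<omega> + partial_gradient N dw R i (\<lambda>k. w t k \<omega>))"
    and "\<And>t \<omega>. t \<in> {1..T} \<Longrightarrow> \<omega> \<in> space M \<Longrightarrow>
           exact_pass N d dw f (\<lambda>i. w t i \<omega>) (x t \<omega>)
             (\<lambda>i. y t i \<omega>) (\<lambda>i. v t i \<omega>) (\<lambda>i. u t i \<omega>)"
  shows "\<forall>t\<in>{1..T}.
    (\<integral>\<^sup>+ \<omega>. ennreal ((vnorm (stack N (\<lambda>i. ut t i \<omega>) - stack N (\<lambda>i. u t i \<omega>)))\<^sup>2) \<partial>M)
    \<le> (\<Sum>i=1..N-1. ennreal (C_delta N C1 Lf L1 i) * (\<integral>\<^sup>+ \<omega>. ennreal ((vnorm (\<delta> t i \<omega>))\<^sup>2) \<partial>M))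
      + (\<Sum>i=1..N-1. ennreal (C_epsilon_Suc C1 i) *
           (\<integral>\<^sup>+ \<omega>. ennreal ((vnorm (\<epsilon> t (i + 1) \<omega>))\<^sup>2) \<partial>M))"
proof
  fix t assume t: "t \<in> {1..T}"
  let ?D = "\<lambda>i \<omega>. ennreal ((vnorm (\<delta> t i \<omega>))\<^sup>2)"
  let ?E = "\<lambda>i \<omega>. ennreal ((vnorm (\<epsilon> t (i + 1) \<omega>))\<^sup>2)"
  note dims = assms(18,19)[OF t]
  \<comment> \<open>A dimension is assumed only for the initial weights. Every later weight vector
    is a difference, whose dimension is that of the subtracted update and thus of the gradient of
    \<open>R\<close>; this needs no induction on \<open>t\<close>.\<close>
  have w: "w t i \<omega> \<in> carrier_vec (dw i)" if i: "i \<in> {1..N}" and \<omega>: "\<omega> \<in> space M" for i \<omega>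
  proof (cases "t = 1")
    case True
    then show ?thesis using assms(16)[OF i] \<omega> by (simp add: random_vec_def)
  next
    case False
    then have "t - 1 \<in> {1..T}" "t = t - 1 + 1" using t by auto
    then have "w t i \<omega> = w (t - 1) i \<omega>
        - \<gamma> \<cdot>\<^sub>v (ut (t - 1) i \<omega> + partial_gradient N dw R i (\<lambda>k. w (t - 1) k \<omega>))"
      using assms(21)[OF _ i \<omega>, of "t - 1"] by simp
    then show ?thesis
      by (simp add: carrier_dim_vec partial_gradient_def gradient_def)
  qed
  have bound: "ennreal ((vnorm (stack N (\<lambda>i. ut t i \<omega>) - stack N (\<lambda>i. u t i \<omega>)))\<^sup>2)
      \<le> (\<Sum>i=1..N-1. ennreal (C_delta N C1 Lf L1 i) * ?D i \<omega>)
        + (\<Sum>i=1..N-1. ennreal (C_epsilon_Suc C1 i) * ?E i \<omega>)" if \<omega>: "\<omega> \<in> space M" for \<omega>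
  proof -
    have "(vnorm (stack N (\<lambda>i. ut t i \<omega>) - stack N (\<lambda>i. u t i \<omega>)))\<^sup>2
      \<le> (\<Sum>i=1..N-1. C_delta N C1 Lf L1 i * (vnorm (\<delta> t i \<omega>))\<^sup>2)
        + (\<Sum>i=1..N-1. C_epsilon_Suc C1 i * (vnorm (\<epsilon> t (i + 1) \<omega>))\<^sup>2)"
    proof (rule pathwise_error_bound[where w = "\<lambda>i. w t i \<omega>" and x = "x t \<omega>" and f = f
          and dw = dw and ?C1.0 = C1 and ?C2.0 = C2 and ?L2.0 = L2 and Lf = Lf])
      show "x t \<omega> \<in> carrier_vec (d 0)"
        using assms(17)[OF t] \<omega> by (simp add: random_vec_def)
      show "\<delta> t i \<omega> \<in> carrier_vec (d i)" if "i \<in> {1..N}" for i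
        using dims(1)[OF that] \<omega> by (simp add: random_vec_def)
      show "\<epsilon> t i \<omega> \<in> carrier_vec (d (i - 1))" if "i \<in> {2..N}" for i
        using dims(2)[OF that] \<omega> by (simp add: random_vec_def)
      show "1 \<le> N" "0 \<le> C1" "0 \<le> L1" "0 \<le> Lf"
        using assms(1,8,10,11) by simp_all
    qed (assumption | rule assms(3,5,13) w[OF _ \<omega>] assms(20,22)[OF t \<omega>])+
    then have "ennreal ((vnorm (stack N (\<lambda>i. ut t i \<omega>) - stack N (\<lambda>i. u t i \<omega>)))\<^sup>2)
      \<le> ennreal ((\<Sum>i=1..N-1. C_delta N C1 Lf L1 i * (vnorm (\<delta> t i \<omega>))\<^sup>2)
        + (\<Sum>i=1..N-1. C_epsilon_Suc C1 i * (vnorm (\<epsilon> t (i + 1) \<omega>))\<^sup>2))"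
      by (rule ennreal_leI)
    \<comment> \<open>Nonnegative coefficients let \<open>ennreal\<close> pass through the sums and
      products.\<close>
    also have "\<dots> = ennreal (\<Sum>i=1..N-1. C_delta N C1 Lf L1 i * (vnorm (\<delta> t i \<omega>))\<^sup>2)
        + ennreal (\<Sum>i=1..N-1. C_epsilon_Suc C1 i * (vnorm (\<epsilon> t (i + 1) \<omega>))\<^sup>2)"
      by (intro ennreal_plus sum_nonneg mult_nonneg_nonneg C_delta_nonneg C_epsilon_Suc_nonneg
          zero_le_power2)
    finally show ?thesis
      by (simp only: sum_ennreal[symmetric] ennreal_mult mult_nonneg_nonneg C_delta_nonneg
          C_epsilon_Suc_nonneg zero_le_power2)
  qed
  have meas: "?D i \<in> borel_measurable M" "?E i \<in> borel_measurable M" if "i \<in> {1..N-1}" for i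
  proof -
    have "i \<in> {1..N}" "i + 1 \<in> {2..N}" using that by auto
    note this(1)[THEN dims(1)] this(2)[THEN dims(2)]
    note this[THEN random_vec_vnorm_measurable, THEN measurable_compose[OF _ measurable_ennreal]]
    then show "?D i \<in> borel_measurable M" "?E i \<in> borel_measurable M" .
  qed
  \<comment> \<open>Monotonicity of the nonnegative integral holds for arbitrary integrands.
    Measurability enters afterwards, when linearity splits the right-hand side into the moments of
    the perturbations.\<close>
  have "(\<integral>\<^sup>+ \<omega>. ennreal ((vnorm (stack N (\<lambda>i. ut t i \<omega>) - stack N (\<lambda>i. u t i \<omega>)))\<^sup>2) \<partial>M)
      \<le> (\<integral>\<^sup>+ \<omega>. (\<Sum>i=1..N-1. ennreal (C_delta N C1 Lf L1 i) * ?D i \<omega>)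
        + (\<Sum>i=1..N-1. ennreal (C_epsilon_Suc C1 i) * ?E i \<omega>) \<partial>M)"
    by (intro nn_integral_mono bound)
  also have "\<dots> = (\<integral>\<^sup>+ \<omega>. (\<Sum>i=1..N-1. ennreal (C_delta N C1 Lf L1 i) * ?D i \<omega>) \<partial>M)
      + (\<integral>\<^sup>+ \<omega>. (\<Sum>i=1..N-1. ennreal (C_epsilon_Suc C1 i) * ?E i \<omega>) \<partial>M)"
    by (intro nn_integral_add borel_measurable_sum borel_measurable_times_ennreal
        borel_measurable_const meas)
  also have "(\<integral>\<^sup>+ \<omega>. (\<Sum>i=1..N-1. ennreal (C_delta N C1 Lf L1 i) * ?D i \<omega>) \<partial>M)
      = (\<Sum>i=1..N-1. ennreal (C_delta N C1 Lf L1 i) * (\<integral>\<^sup>+ \<omega>. ?D i \<omega> \<partial>M))"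
    by (subst nn_integral_sum, intro borel_measurable_times_ennreal borel_measurable_const meas,
        assumption, intro sum.cong nn_integral_cmult meas refl)
  also have "(\<integral>\<^sup>+ \<omega>. (\<Sum>i=1..N-1. ennreal (C_epsilon_Suc C1 i) * ?E i \<omega>) \<partial>M)
      = (\<Sum>i=1..N-1. ennreal (C_epsilon_Suc C1 i) * (\<integral>\<^sup>+ \<omega>. ?E i \<omega> \<partial>M))"
    by (subst nn_integral_sum, intro borel_measurable_times_ennreal borel_measurable_const meas,
        assumption, intro sum.cong nn_integral_cmult meas refl)
  finally show "(\<integral>\<^sup>+ \<omega>. ennreal ((vnorm (stack N (\<lambda>i. ut t i \<omega>) - stack N (\<lambda>i. u t i \<omega>)))\<^sup>2) \<partial>M)
    \<le> (\<Sum>i=1..N-1. ennreal (C_delta N C1 Lf L1 i) * (\<integral>\<^sup>+ \<omega>. ?D i \<omega> \<partial>M))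
      + (\<Sum>i=1..N-1. ennreal (C_epsilon_Suc C1 i) * (\<integral>\<^sup>+ \<omega>. ?E i \<omega> \<partial>M))" .
qed

end
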